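(* Let $I$ and $J$ be two skew-symmetric $(1,1)$-tensors on a pre-Courant algebroid $(E,\Theta)$ such that $I$ is Nijenhuis for $\Theta$ and $(I,J)$ is a compatible pair w.r.t. $\Theta$. Then, for all $k,n,s\in\mathbb{N}$, $C_{\Theta_k}(I^{2s+1},I^n\circ J)=0$ and $(I^{2s+1},I^n\circ J)$ is a compatible pair w.r.t. $\Theta_k$. Moreover, if $J$ is also Nijenhuis for $\Theta$, then, for all $k,m,n,s\in\mathbb{N}$, $C_{\Theta_k}(I^{2s+1},I^n\circ J^{2m+1})=0$ and $(I^{2s+1},I^n\circ J^{2m+1})$ is a compatible pair w.r.t. $\Theta_k$.
   Context: $E\to M$ is a real vector bundle over a smooth manifold with a fibrewise non-degenerate symmetric bilinear form $\langle\cdot,\cdot\rangle$. A pre-Courant structure $\Theta$ on it is a pair $(\rho,[\cdot,\cdot])$, where $\rho:E\to TM$ is a bundle map and $[\cdot,\cdot]$ is an $\mathbb{R}$-bilinear, not necessarily skew-symmetric, bracket on $\Gamma(E)$ such that, for all $X,Y,Z\in\Gamma(E)$, $\rho(X)\cdot\langle Y,Z\rangle=\langle[X,Y],Z\rangle+\langle Y,[X,Z]\rangle$ and $\rho(X)\cdot\langle Y,Z\rangle=\langle X,[Y,Z]+[Z,Y]\rangle$. Then $(E,\Theta)$ is a pre-Courant algebroid. Sums and scalar multiples of pre-Courant structures are taken componentwise. A $(1,1)$-tensor is a vector bundle endomorphism of $E$ over $\mathrm{id}_M$; $J$ is skew-symmetric if $\langle Ju,v\rangle+\langle u,Jv\rangle=0$.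 For $J$ skew-symmetric, $\Theta_J=(\rho\circ J,[\cdot,\cdot]_J)$ with $[X,Y]_J=[JX,Y]+[X,JY]-J[X,Y]$, which is again a pre-Courant structure. Write $\Theta_{I,J}=(\Theta_I)_J$. $\Theta_0=\Theta$ and $\Theta_k=(\Theta_{k-1})_I$ ($k$ successive deformations by $I$). $I^n$ is the $n$-fold composition, $I^0=\mathrm{id}_E$. $\mathbb{N}$ includes $0$. $I$ is Nijenhuis for $\Theta$ if $\mathcal{T}_\Theta I(X,Y)=[IX,IY]-I([X,Y]_I)$ vanishes for all $X,Y\in\Gamma(E)$. The concomitant of skew-symmetric $I,J$ is $C_\Theta(I,J)=\Theta_{I,J}+\Theta_{J,I}$. $(I,J)$ is a compatible pair w.r.t. $\Theta$ if $I$ and $J$ are skew-symmetric, $I\circ J=-J\circ I$ and $C_\Theta(I,J)=0$. *)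

theory Defs
  imports "HOL-Analysis.Analysis"
begin

section \<open>Smooth manifolds\<close>

text \<open>
  The model space of dimension \<open>n\<close> is \<^const>\<open>Euclidean_space\<close> \<open>n\<close>, i.e. the sequences vanishing at all
  indices \<open>\<ge> n\<close>, with the topology induced from \<^typ>\<open>nat \<Rightarrow> real\<close>. The dimension is thus an ordinary
  natural number, and \<open>n = 0\<close> is allowed.
\<close>

definition partial_deriv :: "nat \<Rightarrow> ((nat \<Rightarrow> real) \<Rightarrow> real) \<Rightarrow> (nat \<Rightarrow> real) \<Rightarrow> real" where
  "partial_deriv i f x = deriv (\<lambda>t. f (x(i := t))) (x i)"

text \<open>To be used for \<open>U\<close> open in \<open>Euclidean_space n\<close>.\<close>

fun Ck_on :: "nat \<Rightarrow> nat \<Rightarrow> (nat \<Rightarrow> real) set \<Rightarrow> ((nat \<Rightarrow> real) \<Rightarrow> real) \<Rightarrow> bool" where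
  "Ck_on 0 n U f \<longleftrightarrow> continuous_on U f"
| "Ck_on (Suc k) n U f \<longleftrightarrow> continuous_on U f \<and>
     (\<forall>i<n. (\<forall>x\<in>U. (\<lambda>t. f (x(i := t))) field_differentiable at (x i)) \<and>
            Ck_on k n U (partial_deriv i f))"

definition Cinf_on :: "nat \<Rightarrow> (nat \<Rightarrow> real) set \<Rightarrow> ((nat \<Rightarrow> real) \<Rightarrow> real) \<Rightarrow> bool" where
  "Cinf_on n U f \<longleftrightarrow> (\<forall>k. Ck_on k n U f)"

text \<open>A chart is a pair of a domain and a coordinate map; only the values of the map on the domain matter.\<close>

type_synonym 'm chart = "'m set \<times> ('m \<Rightarrow> nat \<Rightarrow> real)"

definition smooth_atlas :: "nat \<Rightarrow> ('m::topological_space) chart set \<Rightarrow> bool" where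
  "smooth_atlas n \<A> \<longleftrightarrow>
     (\<Union>(U,\<phi>)\<in>\<A>. U) = UNIV \<and>
     (\<forall>(U,\<phi>)\<in>\<A>. open U \<and> openin (Euclidean_space n) (\<phi> ` U) \<and>
        homeomorphism U (\<phi> ` U) \<phi> (inv_into U \<phi>)) \<and>
     (\<forall>(U,\<phi>)\<in>\<A>. \<forall>(V,\<psi>)\<in>\<A>. \<forall>i<n.
        Cinf_on n (\<phi> ` (U \<inter> V)) (\<lambda>y. \<psi> (inv_into U \<phi> y) i))"

definition smooth_fun_on ::
  "nat \<Rightarrow> ('m::topological_space) chart set \<Rightarrow> 'm set \<Rightarrow> ('m \<Rightarrow> real) \<Rightarrow> bool" where
  "smooth_fun_on n \<A> W f \<longleftrightarrow>
     (\<forall>(U,\<phi>)\<in>\<A>. Cinf_on n (\<phi> ` (U \<inter> W)) (\<lambda>y. f (inv_into U \<phi> y)))"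

text \<open>
  Tangent vectors at \<open>x\<close> are regarded as derivations at \<open>x\<close> of the algebra of smooth functions on the
  manifold; \<open>coord_vector (U,\<phi>) i x\<close> is the \<open>i\<close>-th coordinate vector of the chart \<open>(U,\<phi>)\<close> at
  \<open>x \<in> U\<close>. Only the values of a tangent vector on smooth functions matter.
\<close>

type_synonym 'm tangent = "('m \<Rightarrow> real) \<Rightarrow> real"

definition coord_vector :: "'m chart \<Rightarrow> nat \<Rightarrow> 'm \<Rightarrow> 'm tangent" where
  "coord_vector = (\<lambda>(U,\<phi>) i x f. partial_deriv i (\<lambda>y. f (inv_into U \<phi> y)) (\<phi> x))"


section \<open>Vector bundles with a fibrewise non-degenerate symmetric bilinear form\<close>

text \<open>
  The base manifold is the whole type \<open>'m\<close>. The fibres are linear subspaces of one real vector space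
  \<open>'e\<close>, which carries no topology; this loses no generality, since every bundle can be so represented
  (take for \<open>'e\<close> the direct sum of all fibres). The total space is the disjoint union of the fibres,
  and its smooth structure is given by a family of local frames \<open>(V,e)\<close> with smooth transition
  matrices, where \<open>e i x\<close> for \<open>i < rk B\<close> is a basis of the fibre over \<open>x \<in> V\<close>.
\<close>

record ('m,'e) metric_bundle =
  mdim :: nat
  charts :: "'m chart set"
  rk :: nat
  fibre :: "'m \<Rightarrow> 'e set"
  frames :: "('m set \<times> (nat \<Rightarrow> 'm \<Rightarrow> 'e)) set"
  pairing :: "'m \<Rightarrow> 'e \<Rightarrow> 'e \<Rightarrow> real"

abbreviation smooth_on_base ::
  "('m::topological_space,'e) metric_bundle \<Rightarrow> 'm set \<Rightarrow> ('m \<Rightarrow> real) \<Rightarrow> bool" where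
  "smooth_on_base B \<equiv> smooth_fun_on (mdim B) (charts B)"

definition vector_bundle ::
  "('m::{t2_space,second_countable_topology}, 'e::real_vector) metric_bundle \<Rightarrow> bool" where
  "vector_bundle B \<longleftrightarrow>
     smooth_atlas (mdim B) (charts B) \<and>
     (\<forall>x. subspace (fibre B x)) \<and>
     (\<Union>(V,e)\<in>frames B. V) = UNIV \<and>
     (\<forall>(V,e)\<in>frames B. open V \<and>
        (\<forall>x\<in>V. inj_on (\<lambda>i. e i x) {..<rk B} \<and> independent ((\<lambda>i. e i x) ` {..<rk B}) \<and>
               span ((\<lambda>i. e i x) ` {..<rk B}) = fibre B x)) \<and>
     (\<forall>(V,e)\<in>frames B. \<forall>(W,f)\<in>frames B. \<exists>a.
        (\<forall>i<rk B. \<forall>j<rk B. smooth_on_base B (V \<inter> W) (a i j)) \<and>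
        (\<forall>x\<in>V \<inter> W. \<forall>j<rk B. e j x = (\<Sum>i<rk B. a i j x *\<^sub>R f i x)))"

definition metric_vector_bundle ::
  "('m::{t2_space,second_countable_topology}, 'e::real_vector) metric_bundle \<Rightarrow> bool" where
  "metric_vector_bundle B \<longleftrightarrow> vector_bundle B \<and>
     (\<forall>x. \<forall>u\<in>fibre B x. \<forall>v\<in>fibre B x. pairing B x u v = pairing B x v u) \<and>
     (\<forall>x. \<forall>u\<in>fibre B x. \<forall>v\<in>fibre B x. \<forall>w\<in>fibre B x. \<forall>a b.
        pairing B x (a *\<^sub>R u + b *\<^sub>R v) w = a * pairing B x u w + b * pairing B x v w) \<and>
     (\<forall>x. \<forall>u\<in>fibre B x. (\<forall>v\<in>fibre B x. pairing B x u v = 0) \<longrightarrow> u = 0) \<and>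
     (\<forall>(V,e)\<in>frames B. \<forall>i<rk B. \<forall>j<rk B.
        smooth_on_base B V (\<lambda>x. pairing B x (e i x) (e j x)))"

definition sections ::
  "('m::topological_space, 'e::real_vector) metric_bundle \<Rightarrow> ('m \<Rightarrow> 'e) set" where
  "sections B = {X. (\<forall>x. X x \<in> fibre B x) \<and>
     (\<forall>(V,e)\<in>frames B. \<exists>c. (\<forall>i<rk B. smooth_on_base B V (c i)) \<and>
        (\<forall>x\<in>V. X x = (\<Sum>i<rk B. c i x *\<^sub>R e i x)))}"

text \<open>
  Vector bundle endomorphisms over the identity; only the values \<open>J x v\<close> with \<open>v\<close> in the fibre over
  \<open>x\<close> matter.
\<close>

type_synonym ('m,'e) tensor11 = "'m \<Rightarrow> 'e \<Rightarrow> 'e"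

definition tensor11 ::
  "('m::topological_space, 'e::real_vector) metric_bundle \<Rightarrow> ('m,'e) tensor11 \<Rightarrow> bool" where
  "tensor11 B J \<longleftrightarrow>
     (\<forall>x. \<forall>u\<in>fibre B x. J x u \<in> fibre B x) \<and>
     (\<forall>x. \<forall>u\<in>fibre B x. \<forall>v\<in>fibre B x. \<forall>a b.
        J x (a *\<^sub>R u + b *\<^sub>R v) = a *\<^sub>R J x u + b *\<^sub>R J x v) \<and>
     (\<forall>(V,e)\<in>frames B. \<forall>(W,f)\<in>frames B. \<exists>a.
        (\<forall>i<rk B. \<forall>j<rk B. smooth_on_base B (V \<inter> W) (a i j)) \<and>
        (\<forall>x\<in>V \<inter> W. \<forall>j<rk B. J x (e j x) = (\<Sum>i<rk B. a i j x *\<^sub>R f i x)))"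

definition skew_tensor ::
  "('m::topological_space, 'e::real_vector) metric_bundle \<Rightarrow> ('m,'e) tensor11 \<Rightarrow> bool" where
  "skew_tensor B J \<longleftrightarrow> tensor11 B J \<and>
     (\<forall>x. \<forall>u\<in>fibre B x. \<forall>v\<in>fibre B x. pairing B x (J x u) v + pairing B x u (J x v) = 0)"

definition tcomp :: "('m,'e) tensor11 \<Rightarrow> ('m,'e) tensor11 \<Rightarrow> ('m,'e) tensor11" where
  "tcomp I J = (\<lambda>x. I x \<circ> J x)"

definition tpow :: "('m,'e) tensor11 \<Rightarrow> nat \<Rightarrow> ('m,'e) tensor11" where
  "tpow I n = (\<lambda>x. I x ^^ n)"

definition tapp :: "('m,'e) tensor11 \<Rightarrow> ('m \<Rightarrow> 'e) \<Rightarrow> ('m \<Rightarrow> 'e)" where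
  "tapp J X = (\<lambda>x. J x (X x))"

text \<open>
  Bundle maps from the bundle to the tangent bundle, over the identity: fibrewise linear, and with
  smooth coefficients with respect to the local frames and the coordinate vectors of the charts (so
  that the values are indeed tangent vectors).
\<close>

definition anchor_map ::
  "('m::topological_space, 'e::real_vector) metric_bundle \<Rightarrow> ('m \<Rightarrow> 'e \<Rightarrow> 'm tangent) \<Rightarrow> bool" where
  "anchor_map B \<rho> \<longleftrightarrow>
     (\<forall>x. \<forall>u\<in>fibre B x. \<forall>v\<in>fibre B x. \<forall>a b. \<forall>f. smooth_on_base B UNIV f \<longrightarrow>
        \<rho> x (a *\<^sub>R u + b *\<^sub>R v) f = a * \<rho> x u f + b * \<rho> x v f) \<and>
     (\<forall>(V,e)\<in>frames B. \<forall>(U,\<phi>)\<in>charts B. \<exists>a.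
        (\<forall>i<mdim B. \<forall>j<rk B. smooth_on_base B (V \<inter> U) (a i j)) \<and>
        (\<forall>x\<in>V \<inter> U. \<forall>j<rk B. \<forall>f. smooth_on_base B UNIV f \<longrightarrow>
           \<rho> x (e j x) f = (\<Sum>i<mdim B. a i j x * coord_vector (U,\<phi>) i x f)))"


section \<open>Pre-Courant structures\<close>

text \<open>A pair of an anchor and a bracket; only the values of the bracket on sections matter.\<close>

type_synonym ('m,'e) courant_data =
  "('m \<Rightarrow> 'e \<Rightarrow> 'm tangent) \<times> (('m \<Rightarrow> 'e) \<Rightarrow> ('m \<Rightarrow> 'e) \<Rightarrow> ('m \<Rightarrow> 'e))"

abbreviation anchor :: "('m,'e) courant_data \<Rightarrow> 'm \<Rightarrow> 'e \<Rightarrow> 'm tangent" where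
  "anchor \<equiv> fst"

abbreviation bracket :: "('m,'e) courant_data \<Rightarrow> ('m \<Rightarrow> 'e) \<Rightarrow> ('m \<Rightarrow> 'e) \<Rightarrow> ('m \<Rightarrow> 'e)" where
  "bracket \<equiv> snd"

definition pre_courant_structure ::
  "('m::topological_space, 'e::real_vector) metric_bundle \<Rightarrow> ('m,'e) courant_data \<Rightarrow> bool" where
  "pre_courant_structure B \<Theta> \<longleftrightarrow>
     anchor_map B (anchor \<Theta>) \<and>
     (\<forall>X\<in>sections B. \<forall>Y\<in>sections B. bracket \<Theta> X Y \<in> sections B) \<and>
     (\<forall>X\<in>sections B. \<forall>Y\<in>sections B. \<forall>Z\<in>sections B. \<forall>a b.
        bracket \<Theta> (\<lambda>x. a *\<^sub>R X x + b *\<^sub>R Y x) Z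
          = (\<lambda>x. a *\<^sub>R bracket \<Theta> X Z x + b *\<^sub>R bracket \<Theta> Y Z x) \<and>
        bracket \<Theta> Z (\<lambda>x. a *\<^sub>R X x + b *\<^sub>R Y x)
          = (\<lambda>x. a *\<^sub>R bracket \<Theta> Z X x + b *\<^sub>R bracket \<Theta> Z Y x)) \<and>
     (\<forall>X\<in>sections B. \<forall>Y\<in>sections B. \<forall>Z\<in>sections B. \<forall>x.
        anchor \<Theta> x (X x) (\<lambda>y. pairing B y (Y y) (Z y))
          = pairing B x (bracket \<Theta> X Y x) (Z x) + pairing B x (Y x) (bracket \<Theta> X Z x) \<and>
        anchor \<Theta> x (X x) (\<lambda>y. pairing B y (Y y) (Z y))
          = pairing B x (X x) (bracket \<Theta> Y Z x + bracket \<Theta> Z Y x))"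

definition pre_courant_algebroid ::
  "('m::{t2_space,second_countable_topology}, 'e::real_vector) metric_bundle \<Rightarrow>
   ('m,'e) courant_data \<Rightarrow> bool" where
  "pre_courant_algebroid B \<Theta> \<longleftrightarrow> metric_vector_bundle B \<and> pre_courant_structure B \<Theta>"

definition plus_structure ::
  "('m,'e::real_vector) courant_data \<Rightarrow> ('m,'e) courant_data \<Rightarrow> ('m,'e) courant_data" where
  "plus_structure \<Theta> \<Xi> =
     (\<lambda>x u f. anchor \<Theta> x u f + anchor \<Xi> x u f,
      \<lambda>X Y x. bracket \<Theta> X Y x + bracket \<Xi> X Y x)"

definition zero_structure ::
  "('m::topological_space, 'e::real_vector) metric_bundle \<Rightarrow> ('m,'e) courant_data \<Rightarrow> bool" where
  "zero_structure B \<Theta> \<longleftrightarrow>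
     (\<forall>x. \<forall>u\<in>fibre B x. \<forall>f. smooth_on_base B UNIV f \<longrightarrow> anchor \<Theta> x u f = 0) \<and>
     (\<forall>X\<in>sections B. \<forall>Y\<in>sections B. \<forall>x. bracket \<Theta> X Y x = 0)"

definition deform ::
  "('m,'e::real_vector) courant_data \<Rightarrow> ('m,'e) tensor11 \<Rightarrow> ('m,'e) courant_data" where
  "deform \<Theta> J =
     (\<lambda>x u. anchor \<Theta> x (J x u),
      \<lambda>X Y x. bracket \<Theta> (tapp J X) Y x + bracket \<Theta> X (tapp J Y) x - J x (bracket \<Theta> X Y x))"

primrec deform_iter ::
  "('m,'e::real_vector) courant_data \<Rightarrow> ('m,'e) tensor11 \<Rightarrow> nat \<Rightarrow> ('m,'e) courant_data" where
  "deform_iter \<Theta> I 0 = \<Theta>"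
| "deform_iter \<Theta> I (Suc k) = deform (deform_iter \<Theta> I k) I"

definition torsion ::
  "('m,'e::real_vector) courant_data \<Rightarrow> ('m,'e) tensor11 \<Rightarrow> ('m \<Rightarrow> 'e) \<Rightarrow> ('m \<Rightarrow> 'e) \<Rightarrow> ('m \<Rightarrow> 'e)" where
  "torsion \<Theta> I X Y =
     (\<lambda>x. bracket \<Theta> (tapp I X) (tapp I Y) x - I x (bracket (deform \<Theta> I) X Y x))"

definition nijenhuis ::
  "('m::topological_space, 'e::real_vector) metric_bundle \<Rightarrow> ('m,'e) courant_data \<Rightarrow>
   ('m,'e) tensor11 \<Rightarrow> bool" where
  "nijenhuis B \<Theta> I \<longleftrightarrow> (\<forall>X\<in>sections B. \<forall>Y\<in>sections B. \<forall>x. torsion \<Theta> I X Y x = 0)"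

definition concomitant ::
  "('m,'e::real_vector) courant_data \<Rightarrow> ('m,'e) tensor11 \<Rightarrow> ('m,'e) tensor11 \<Rightarrow> ('m,'e) courant_data" where
  "concomitant \<Theta> I J = plus_structure (deform (deform \<Theta> I) J) (deform (deform \<Theta> J) I)"

definition compatible_pair ::
  "('m::topological_space, 'e::real_vector) metric_bundle \<Rightarrow> ('m,'e) courant_data \<Rightarrow>
   ('m,'e) tensor11 \<Rightarrow> ('m,'e) tensor11 \<Rightarrow> bool" where
  "compatible_pair B \<Theta> I J \<longleftrightarrow>
     skew_tensor B I \<and> skew_tensor B J \<and>
     (\<forall>x. \<forall>u\<in>fibre B x. tcomp I J x u = - tcomp J I x u) \<and>
     zero_structure B (concomitant \<Theta> I J)"

end

theory Submission
  imports Defs "HOL-Library.Function_Algebras"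
begin

text \<open>
  Write \<open>\<delta>\<^sub>A \<mu> = \<mu>(A \<cdot>, \<cdot>) + \<mu>(\<cdot>, A \<cdot>) - A \<mu>(\<cdot>, \<cdot>)\<close> for the deformation of a bracket \<open>\<mu>\<close> by \<open>A\<close>. Then
  \<open>\<delta>\<close> is a Lie algebra anti-homomorphism, and compatibility of \<open>(I, J)\<close> says that \<open>I, J\<close> as well as
  \<open>\<delta>\<^sub>I, \<delta>\<^sub>J\<close> anticommute on \<open>\<mu>\<close>. If moreover \<open>I\<close> is Nijenhuis for \<open>\<mu>\<close>, it is Nijenhuis for \<open>\<delta>\<^sub>I \<mu>\<close> and
  \<open>\<delta>\<^sub>J \<mu>\<close>, and for every bracket for which \<open>I\<close> is Nijenhuis, \<open>k\<close> deformations by \<open>I\<close> amount to one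
  by \<open>I\<^sup>k\<close>. Hence \<open>(\<delta>\<^sub>J \<delta>\<^sub>I + \<delta>\<^sub>I \<delta>\<^sub>J) \<delta>\<^sub>I \<mu>\<close> is the commutator of \<open>\<delta>\<^sub>J\<close> and \<open>\<delta>\<close> of \<open>I\<^sup>2\<close> applied to \<open>\<mu>\<close>, which
  vanishes as \<open>I\<^sup>2\<close> and \<open>J\<close> commute: compatibility passes to \<open>\<delta>\<^sub>I \<mu>\<close>. It passes to \<open>I \<circ> J\<close> because
  \<open>\<delta>\<close> of \<open>I \<circ> J\<close> is \<open>\<delta>\<^sub>J \<delta>\<^sub>I\<close> on \<open>\<mu>\<close> and \<open>\<delta>\<^sub>I \<mu>\<close>, and to odd powers of \<open>I\<close> because \<open>\<delta>\<^sub>J\<close> anticommutes with an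
  odd power of \<open>\<delta>\<^sub>I\<close>. If \<open>J\<close> is Nijenhuis too, the roles can be swapped: \<open>I\<close> is compatible with the odd
  powers of \<open>J\<close>, and the first part applies to those.
\<close>

section \<open>Brackets on an abelian group\<close>

definition deform_br :: "('a::ab_group_add \<Rightarrow> 'a) \<Rightarrow> ('a \<Rightarrow> 'a \<Rightarrow> 'a) \<Rightarrow> 'a \<Rightarrow> 'a \<Rightarrow> 'a" where
  "deform_br A \<mu> X Y = \<mu> (A X) Y + \<mu> X (A Y) - A (\<mu> X Y)"

text \<open>Models the sections inside the group of all maps from the base to the fibre space: maps
  and brackets are controlled on \<open>S\<close> only. Absence of 2-torsion stands in for division
  by 2 and suffices to cancel a factor 2.\<close>

locale additive_carrier =
  fixes S :: "'a::ab_group_add set"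
  assumes add_mem: "X \<in> S \<Longrightarrow> Y \<in> S \<Longrightarrow> X + Y \<in> S"
    and uminus_mem: "X \<in> S \<Longrightarrow> - X \<in> S"
    and no_two_torsion: "(v::'a) + v = 0 \<Longrightarrow> v = 0"
begin

lemma diff_mem: "X \<in> S \<Longrightarrow> Y \<in> S \<Longrightarrow> X - Y \<in> S"
  using add_mem[of X "- Y"] uminus_mem[of Y] by simp

lemmas mem = add_mem uminus_mem diff_mem

definition endo :: "('a \<Rightarrow> 'a) \<Rightarrow> bool" where
  "endo A \<longleftrightarrow> (\<forall>X\<in>S. A X \<in> S) \<and> (\<forall>X\<in>S. \<forall>Y\<in>S. A (X + Y) = A X + A Y)"

definition biadditive :: "('a \<Rightarrow> 'a \<Rightarrow> 'a) \<Rightarrow> bool" where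
  "biadditive \<mu> \<longleftrightarrow> (\<forall>X\<in>S. endo (\<mu> X)) \<and> (\<forall>Y\<in>S. endo (\<lambda>X. \<mu> X Y))"

definition nij :: "('a \<Rightarrow> 'a) \<Rightarrow> ('a \<Rightarrow> 'a \<Rightarrow> 'a) \<Rightarrow> bool" where
  "nij A \<mu> \<longleftrightarrow> (\<forall>X\<in>S. \<forall>Y\<in>S. \<mu> (A X) (A Y) = A (deform_br A \<mu> X Y))"

definition concom :: "('a \<Rightarrow> 'a) \<Rightarrow> ('a \<Rightarrow> 'a) \<Rightarrow> ('a \<Rightarrow> 'a \<Rightarrow> 'a) \<Rightarrow> 'a \<Rightarrow> 'a \<Rightarrow> 'a" where
  "concom A C \<mu> X Y = deform_br C (deform_br A \<mu>) X Y + deform_br A (deform_br C \<mu>) X Y"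

definition anticommute :: "('a \<Rightarrow> 'a) \<Rightarrow> ('a \<Rightarrow> 'a) \<Rightarrow> bool" where
  "anticommute A C \<longleftrightarrow> (\<forall>X\<in>S. A (C X) = - C (A X))"

section \<open>Additive maps and biadditive brackets\<close>

lemma endo_mem: "endo A \<Longrightarrow> X \<in> S \<Longrightarrow> A X \<in> S"
  and endo_add: "endo A \<Longrightarrow> X \<in> S \<Longrightarrow> Y \<in> S \<Longrightarrow> A (X + Y) = A X + A Y"
  by (auto simp: endo_def)

lemma endo_diff:
  assumes "endo A" "X \<in> S" "Y \<in> S"
  shows "A (X - Y) = A X - A Y"
  using endo_add[OF assms(1) diff_mem[OF assms(2,3)] assms(3)] by simp

lemma endo_uminus:
  assumes "endo A" "X \<in> S"
  shows "A (- X) = - A X"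
  using endo_diff[OF assms(1) diff_mem[OF assms(2,2)] assms(2)] endo_diff[OF assms(1,2,2)] by simp

lemmas endo_simps = endo_mem endo_add endo_diff endo_uminus

lemma biadditive_simps:
  assumes "biadditive \<mu>" "X \<in> S" "Y \<in> S"
  shows "\<mu> X Y \<in> S"
    and "Z \<in> S \<Longrightarrow> \<mu> (X + Y) Z = \<mu> X Z + \<mu> Y Z"
    and "Z \<in> S \<Longrightarrow> \<mu> (X - Y) Z = \<mu> X Z - \<mu> Y Z"
    and "Z \<in> S \<Longrightarrow> \<mu> Z (X + Y) = \<mu> Z X + \<mu> Z Y"
    and "Z \<in> S \<Longrightarrow> \<mu> Z (X - Y) = \<mu> Z X - \<mu> Z Y"
    and "\<mu> (- X) Y = - \<mu> X Y"
    and "\<mu> X (- Y) = - \<mu> X Y"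
proof -
  have l: "endo (\<lambda>X. \<mu> X Z)" and r: "endo (\<mu> Z)" if "Z \<in> S" for Z
    using assms(1) that by (auto simp: biadditive_def)
  show "\<mu> X Y \<in> S" "\<mu> (- X) Y = - \<mu> X Y" "\<mu> X (- Y) = - \<mu> X Y"
    using endo_simps[OF r] endo_simps[OF l] assms by auto
  show "Z \<in> S \<Longrightarrow> \<mu> (X + Y) Z = \<mu> X Z + \<mu> Y Z"
    "Z \<in> S \<Longrightarrow> \<mu> (X - Y) Z = \<mu> X Z - \<mu> Y Z"
    "Z \<in> S \<Longrightarrow> \<mu> Z (X + Y) = \<mu> Z X + \<mu> Z Y"
    "Z \<in> S \<Longrightarrow> \<mu> Z (X - Y) = \<mu> Z X - \<mu> Z Y"
    using endo_simps[OF r] endo_simps[OF l] assms by auto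
qed

lemma endo_comp: "endo A \<Longrightarrow> endo C \<Longrightarrow> endo (\<lambda>X. A (C X))"
  by (simp add: endo_def)

lemma endo_funpow: "endo A \<Longrightarrow> endo (A ^^ n)"
  by (induction n) (auto simp: endo_def)

section \<open>Deformations and their commutators\<close>

lemma biadditive_deform_br:
  assumes "endo A" "biadditive \<mu>"
  shows "biadditive (deform_br A \<mu>)"
  unfolding biadditive_def endo_def
  by (auto simp: deform_br_def mem endo_simps[OF assms(1)] biadditive_simps[OF assms(2)])

text \<open>Identities between brackets hold only for arguments in \<open>S\<close>, so they are no
  equations of functions; this is how they are applied under a further deformation.\<close>

lemma deform_br_cong:
  assumes "endo A" "\<And>X Y. X \<in> S \<Longrightarrow> Y \<in> S \<Longrightarrow> \<mu> X Y = \<nu> X Y" "X \<in> S" "Y \<in> S"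
  shows "deform_br A \<mu> X Y = deform_br A \<nu> X Y"
  using assms by (simp add: deform_br_def endo_mem)

text \<open>Actions of \<open>A\<close> and \<open>C\<close> on different slots (the two arguments
  and the value) commute and cancel in the difference. In each slot the commutator remains; the
  reversed order makes \<delta> an anti-homomorphism.\<close>

lemma deform_br_commutator:
  assumes "endo A" "endo C" "biadditive \<mu>" "X \<in> S" "Y \<in> S"
  shows "deform_br C (deform_br A \<mu>) X Y - deform_br A (deform_br C \<mu>) X Y
    = deform_br (\<lambda>X. A (C X) - C (A X)) \<mu> X Y"
  using assms(4,5)
  by (simp add: deform_br_def mem endo_simps[OF assms(1)] endo_simps[OF assms(2)]
      biadditive_simps[OF assms(3)] algebra_simps)

lemma deform_br_commute:
  assumes "endo A" "endo C" "biadditive \<mu>" "\<And>X. X \<in> S \<Longrightarrow> A (C X) = C (A X)" "X \<in> S" "Y \<in> S"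
  shows "deform_br C (deform_br A \<mu>) X Y = deform_br A (deform_br C \<mu>) X Y"
  using assms(4-)
  by (simp add: deform_br_def mem endo_simps[OF assms(1)] endo_simps[OF assms(2)]
      biadditive_simps[OF assms(3)] algebra_simps)

section \<open>Nijenhuis maps and iterated deformations\<close>

lemma nij_deform_br_self:
  assumes "endo A" "biadditive \<mu>" "nij A \<mu>"
  shows "nij A (deform_br A \<mu>)"
proof -
  \<comment> \<open>The Nijenhuis relation, oriented so that rewriting removes a common
    \<open>A\<close> from the two arguments.\<close>
  have n: "\<mu> (A X) (A Y) = A (\<mu> (A X) Y) + A (\<mu> X (A Y)) - A (A (\<mu> X Y))" if "X \<in> S" "Y \<in> S" for X Y
    using assms(3) that
    by (simp add: nij_def deform_br_def mem endo_simps[OF assms(1)] biadditive_simps[OF assms(2)])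
  show ?thesis
    \<comment> \<open>The relation for the deformed bracket at \<open>(X, Y)\<close> is the sum of
      those for \<mu> at \<open>(A X, Y)\<close> and \<open>(X, A Y)\<close>, minus \<open>A\<close>
      applied to the one at \<open>(X, Y)\<close>.\<close>
    unfolding nij_def
    by (auto simp: deform_br_def mem endo_simps[OF assms(1)] biadditive_simps[OF assms(2)] n
        algebra_simps)
qed

lemma biadditive_iter: "endo A \<Longrightarrow> biadditive \<mu> \<Longrightarrow> biadditive ((deform_br A ^^ k) \<mu>)"
  by (induction k) (auto intro: biadditive_deform_br)

lemma nij_iter: "endo A \<Longrightarrow> biadditive \<mu> \<Longrightarrow> nij A \<mu> \<Longrightarrow> nij A ((deform_br A ^^ k) \<mu>)"
  by (induction k) (auto intro: nij_deform_br_self biadditive_iter)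

text \<open>The mixed torsion of \<open>A ^^ k\<close> and \<open>A\<close> vanishes. In the
  induction step the Nijenhuis relation at \<open>((A ^^ k) X, Y)\<close> yields a term to which the
  induction hypothesis applies, and the terms with \<open>A\<close> applied twice to
  \<open>\<mu> ((A ^^ k) X) Y\<close> cancel. As \<mu> need not be skew-symmetric, both argument
  orders are stated.\<close>

lemma nij_funpow:
  assumes "endo A" "biadditive \<mu>" "nij A \<mu>" "X \<in> S" "Y \<in> S"
  shows "\<mu> ((A ^^ k) X) (A Y)
      = A (\<mu> ((A ^^ k) X) Y) + (A ^^ k) (\<mu> X (A Y)) - (A ^^ Suc k) (\<mu> X Y)"
    and "\<mu> (A X) ((A ^^ k) Y)
      = A (\<mu> X ((A ^^ k) Y)) + (A ^^ k) (\<mu> (A X) Y) - (A ^^ Suc k) (\<mu> X Y)"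
proof -
  note E = endo_simps[OF assms(1)] endo_simps[OF endo_funpow[OF assms(1)]]
  have n: "\<mu> (A X) (A Y) = A (\<mu> (A X) Y) + A (\<mu> X (A Y)) - A (A (\<mu> X Y))" if "X \<in> S" "Y \<in> S" for X Y
    using assms(3) that
    by (simp add: nij_def deform_br_def mem E biadditive_simps[OF assms(2)])
  note XY = assms(4,5)
  show "\<mu> ((A ^^ k) X) (A Y)
      = A (\<mu> ((A ^^ k) X) Y) + (A ^^ k) (\<mu> X (A Y)) - (A ^^ Suc k) (\<mu> X Y)"
  proof (induction k)
    case (Suc k)
    then show ?case
      using XY by (simp add: n mem E biadditive_simps[OF assms(2)])
  qed simp
  show "\<mu> (A X) ((A ^^ k) Y)
      = A (\<mu> X ((A ^^ k) Y)) + (A ^^ k) (\<mu> (A X) Y) - (A ^^ Suc k) (\<mu> X Y)"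
  proof (induction k)
    case (Suc k)
    then show ?case
      using XY by (simp add: n mem E biadditive_simps[OF assms(2)])
  qed simp
qed

text \<open>Splitting off the innermost deformation leaves \<open>k\<close> deformations of
  \<open>deform_br A \<mu>\<close>, for which \<open>A\<close> is again Nijenhuis; hence the
  induction over all brackets. The mixed terms of the deformation by \<open>A ^^ k\<close> after
  that by \<open>A\<close> are then removed by \<open>nij_funpow\<close>.\<close>

lemma deform_br_funpow:
  assumes "endo A" "biadditive \<mu>" "nij A \<mu>" "X \<in> S" "Y \<in> S"
  shows "(deform_br A ^^ k) \<mu> X Y = deform_br (A ^^ k) \<mu> X Y"
  using assms(2-)
proof (induction k arbitrary: \<mu> X Y)
  case 0
  then show ?case by (simp add: deform_br_def)
next
  case (Suc k)
  note E = endo_simps[OF assms(1)] endo_simps[OF endo_funpow[OF assms(1)]]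
  have "(deform_br A ^^ Suc k) \<mu> X Y = (deform_br A ^^ k) (deform_br A \<mu>) X Y"
    by (simp add: funpow_swap1)
  also have "\<dots> = deform_br (A ^^ k) (deform_br A \<mu>) X Y"
    using Suc assms(1) by (intro Suc.IH biadditive_deform_br nij_deform_br_self) auto
  also have "\<dots> = deform_br (A ^^ Suc k) \<mu> X Y"
    using Suc.prems(3,4)
    by (simp add: deform_br_def mem E biadditive_simps[OF Suc.prems(1)] funpow_swap1
        nij_funpow[OF assms(1) Suc.prems(1,2)] algebra_simps)
  finally show ?case .
qed

text \<open>Anticommutation moves \<open>A\<close> next to the argument of \<mu>, and the Nijenhuis
  relation then pulls it out of the bracket: the torsion of \<open>A\<close> for
  \<open>deform_br C \<mu>\<close> turns out to be \<open>- A\<close> of the concomitant.\<close>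

lemma nij_deform_br_other:
  assumes "endo A" "endo C" "biadditive \<mu>" "nij A \<mu>" "anticommute A C"
    and "\<And>X Y. X \<in> S \<Longrightarrow> Y \<in> S \<Longrightarrow> concom A C \<mu> X Y = 0"
  shows "nij A (deform_br C \<mu>)"
  unfolding nij_def
proof (intro ballI)
  fix X Y assume XY: "X \<in> S" "Y \<in> S"
  note E = mem endo_simps[OF assms(1)] endo_simps[OF assms(2)] biadditive_simps[OF assms(3)]
  have n: "\<mu> (A X) (A Y) = A (\<mu> (A X) Y) + A (\<mu> X (A Y)) - A (A (\<mu> X Y))" if "X \<in> S" "Y \<in> S" for X Y
    using assms(4) that by (simp add: nij_def deform_br_def E)
  have a: "C (A X) = - A (C X)" if "X \<in> S" for X
    using assms(5) that by (simp add: anticommute_def)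
  have "A (concom A C \<mu> X Y) = A 0"
    using assms(6) XY by simp
  also have "A 0 = 0"
    \<comment> \<open>Nothing makes \<open>S\<close> nonempty, so \<open>A 0 = 0\<close> is read off
      from \<open>X - X\<close> for the given \<open>X\<close>.\<close>
    using endo_diff[OF assms(1) XY(1) XY(1)] by simp
  finally have c: "A (concom A C \<mu> X Y) = 0" .
  have "deform_br C \<mu> (A X) (A Y) - A (deform_br A (deform_br C \<mu>) X Y) = - A (concom A C \<mu> X Y)"
    using XY by (simp add: concom_def deform_br_def E a n algebra_simps)
  with c show "deform_br C \<mu> (A X) (A Y) = A (deform_br A (deform_br C \<mu>) X Y)"
    by simp
qed

lemma anticommute_funpow:
  assumes "endo A" "endo C" "anticommute A C" "X \<in> S"
  shows "(A ^^ n) (C X) = (if even n then C ((A ^^ n) X) else - C ((A ^^ n) X))"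
  using assms(3,4)
  by (induction n) (auto simp: anticommute_def endo_simps[OF assms(1)] endo_simps[OF assms(2)]
      endo_simps[OF endo_funpow[OF assms(1)]])

section \<open>Compatible pairs for a bracket\<close>

lemma concom_uminus_swap:
  assumes "concom A C \<mu> X Y = 0"
  shows "deform_br C (deform_br A \<mu>) X Y = - deform_br A (deform_br C \<mu>) X Y"
  using assms by (simp add: concom_def eq_neg_iff_add_eq_0)

lemma deform_br_uminus_arg:
  assumes "endo A" "biadditive \<mu>" "X \<in> S" "Y \<in> S"
  shows "deform_br A (\<lambda>X Y. - \<mu> X Y) X Y = - deform_br A \<mu> X Y"
  using assms(3,4)
  by (simp add: deform_br_def endo_simps[OF assms(1)] biadditive_simps[OF assms(2)])

text \<open>The part of compatibility that concerns the bracket alone; skew-symmetry and the anchor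
  are treated on the bundle.\<close>

definition compat :: "('a \<Rightarrow> 'a) \<Rightarrow> ('a \<Rightarrow> 'a) \<Rightarrow> ('a \<Rightarrow> 'a \<Rightarrow> 'a) \<Rightarrow> bool" where
  "compat A C \<mu> \<longleftrightarrow> anticommute A C \<and> (\<forall>X\<in>S. \<forall>Y\<in>S. concom A C \<mu> X Y = 0)"

text \<open>Two deformations by \<open>A\<close> are one by \<open>A ^^ 2\<close>, which commutes
  with \<open>C\<close> since two signs cancel. So the double deformation by \<open>A\<close>
  commutes with that by \<open>C\<close> on \<mu>, while moving a single one past \<open>C\<close>
  costs a sign.\<close>

lemma compat_deform_br:
  assumes A: "endo A" and C: "endo C" and \<mu>: "biadditive \<mu>" and N: "nij A \<mu>" and K: "compat A C \<mu>"
  shows "compat A C (deform_br A \<mu>)"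
proof -
  have anti: "anticommute A C"
    using K by (simp add: compat_def)
  have K0: "concom A C \<mu> X Y = 0" if "X \<in> S" "Y \<in> S" for X Y
    using K that by (simp add: compat_def)
  have "concom A C (deform_br A \<mu>) X Y = 0" if XY: "X \<in> S" "Y \<in> S" for X Y
  proof -
    note bC = biadditive_deform_br[OF C \<mu>]
    \<comment> \<open>Needed to merge the two outer deformations by \<open>A\<close> when the
      innermost one is by \<open>C\<close>.\<close>
    have NC: "nij A (deform_br C \<mu>)"
      using nij_deform_br_other[OF A C \<mu> N anti K0] .
    have sq: "deform_br A (deform_br A \<nu>) X Y = deform_br (A ^^ 2) \<nu> X Y"
      if "biadditive \<nu>" "nij A \<nu>" "X \<in> S" "Y \<in> S" for \<nu> X Y
      using deform_br_funpow[OF A that, of 2] by (simp add: numeral_2_eq_2)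
    have "deform_br A (deform_br C (deform_br A \<mu>)) X Y
        = deform_br A (\<lambda>X Y. - deform_br A (deform_br C \<mu>) X Y) X Y"
      using concom_uminus_swap[OF K0] XY by (intro deform_br_cong A) auto
    also have "\<dots> = - deform_br A (deform_br A (deform_br C \<mu>)) X Y"
      by (intro deform_br_uminus_arg biadditive_deform_br A bC XY)
    also have "\<dots> = - deform_br (A ^^ 2) (deform_br C \<mu>) X Y"
      by (simp add: sq bC NC XY)
    also have "deform_br (A ^^ 2) (deform_br C \<mu>) X Y = deform_br C (deform_br (A ^^ 2) \<mu>) X Y"
      using anticommute_funpow[OF A C anti, where n = 2] XY
      by (intro deform_br_commute[symmetric] endo_funpow A C \<mu>) auto
    also have "\<dots> = deform_br C (deform_br A (deform_br A \<mu>)) X Y"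
      using XY by (intro deform_br_cong C) (auto simp: sq \<mu> N)
    finally show ?thesis
      by (simp add: concom_def)
  qed
  then show ?thesis
    using K by (simp add: compat_def)
qed

lemma compat_iter:
  assumes "endo A" "endo C" "biadditive \<mu>" "nij A \<mu>" "compat A C \<mu>"
  shows "compat A C ((deform_br A ^^ k) \<mu>)"
  using assms by (induction k) (simp_all add: compat_deform_br nij_iter biadditive_iter)

text \<open>Anticommutation makes \<open>A \<circ> C\<close> half of the commutator of
  \<open>A\<close> and \<open>C\<close>, so its deformation is half of a commutator of deformations;
  the two terms of the latter agree by compatibility.\<close>

lemma deform_br_double:
  assumes "endo A" "endo C" "biadditive \<mu>" "compat A C \<mu>" "X \<in> S" "Y \<in> S"
  shows "deform_br (\<lambda>X. A (C X)) \<mu> X Y = deform_br C (deform_br A \<mu>) X Y"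
proof -
  have "concom A C \<mu> X Y = 0" and a: "\<And>X. X \<in> S \<Longrightarrow> A (C X) = - C (A X)"
    using assms by (auto simp: compat_def anticommute_def)
  then have e: "deform_br A (deform_br C \<mu>) X Y = - deform_br C (deform_br A \<mu>) X Y"
    by (simp add: concom_def add_eq_0_iff)
  \<comment> \<open>Twice the claim is proved first, since an abelian group offers no
    halves.\<close>
  have "deform_br (\<lambda>X. A (C X)) \<mu> X Y + deform_br (\<lambda>X. A (C X)) \<mu> X Y
      = deform_br (\<lambda>X. A (C X) - C (A X)) \<mu> X Y"
    using assms(5,6)
    by (simp add: deform_br_def mem endo_simps[OF assms(1)] endo_simps[OF assms(2)]
        biadditive_simps[OF assms(3)] a)
  also have "\<dots> = deform_br C (deform_br A \<mu>) X Y + deform_br C (deform_br A \<mu>) X Y"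
    using deform_br_commutator[OF assms(1-3,5,6)] e by simp
  finally have "(deform_br (\<lambda>X. A (C X)) \<mu> X Y - deform_br C (deform_br A \<mu>) X Y)
      + (deform_br (\<lambda>X. A (C X)) \<mu> X Y - deform_br C (deform_br A \<mu>) X Y) = 0"
    by (simp add: algebra_simps)
  from no_two_torsion[OF this] show ?thesis
    by simp
qed

text \<open>By \<open>deform_br_double\<close>, for \<mu> and for \<open>deform_br A \<mu>\<close>,
  deforming by \<open>A \<circ> C\<close> is deforming by \<open>A\<close> and then by
  \<open>C\<close>. The claim thus reduces to anticommutation of the deformations on
  \<open>deform_br A \<mu>\<close>.\<close>

lemma compat_comp:
  assumes A: "endo A" and C: "endo C" and \<mu>: "biadditive \<mu>" and N: "nij A \<mu>" and K: "compat A C \<mu>"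
  shows "compat A (\<lambda>X. A (C X)) \<mu>"
proof -
  let ?D = "\<lambda>X. A (C X)"
  have anti: "anticommute A ?D"
    using K by (simp add: compat_def anticommute_def endo_simps[OF A] endo_simps[OF C])
  note bA = biadditive_deform_br[OF A \<mu>]
  note KA = compat_deform_br[OF A C \<mu> N K]
  have swap: "deform_br C (deform_br A \<nu>) X Y = - deform_br A (deform_br C \<nu>) X Y"
    if "compat A C \<nu>" "X \<in> S" "Y \<in> S" for \<nu> X Y
    using that by (intro concom_uminus_swap) (simp add: compat_def)
  have "concom A ?D \<mu> X Y = 0" if XY: "X \<in> S" "Y \<in> S" for X Y
  proof -
    have "deform_br ?D (deform_br A \<mu>) X Y = deform_br C (deform_br A (deform_br A \<mu>)) X Y"
      by (rule deform_br_double[OF A C bA KA XY])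
    also have "\<dots> = - deform_br A (deform_br C (deform_br A \<mu>)) X Y"
      by (rule swap[OF KA XY])
    also have "deform_br A (deform_br C (deform_br A \<mu>)) X Y = deform_br A (deform_br ?D \<mu>) X Y"
      using XY deform_br_double[OF A C \<mu> K] by (intro deform_br_cong A) auto
    finally show ?thesis
      by (simp add: concom_def)
  qed
  then show ?thesis
    using anti by (simp add: compat_def)
qed

lemma endo_funpow_comp: "endo A \<Longrightarrow> endo C \<Longrightarrow> endo ((A ^^ n) \<circ> C)"
  by (simp add: endo_comp endo_funpow o_def)

lemma compat_funpow_comp:
  assumes "endo A" "endo C" "biadditive \<mu>" "nij A \<mu>" "compat A C \<mu>"
  shows "compat A ((A ^^ n) \<circ> C) \<mu>"
proof (induction n)
  case 0
  then show ?case using assms by simp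
next
  case (Suc n)
  from compat_comp[OF assms(1) endo_funpow_comp[OF assms(1,2)] assms(3,4) this]
  show ?case
    by (simp add: o_def)
qed

text \<open>For \<mu> and for \<open>deform_br C \<mu>\<close> alike, deforming by
  \<open>A ^^ a\<close> is deforming \<open>a\<close> times by \<open>A\<close>; the deformation by
  \<open>C\<close> passes these with \<open>a\<close> signs, of which one survives.\<close>

lemma compat_odd_funpow:
  assumes A: "endo A" and C: "endo C" and \<mu>: "biadditive \<mu>" and N: "nij A \<mu>" and K: "compat A C \<mu>"
    and "odd a"
  shows "compat (A ^^ a) C \<mu>"
proof -
  have anti: "anticommute A C"
    using K by (simp add: compat_def)
  have K0: "concom A C \<mu> X Y = 0" if "X \<in> S" "Y \<in> S" for X Y
    using K that by (simp add: compat_def)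
  have swap: "deform_br C ((deform_br A ^^ n) \<mu>) X Y
      = (if even n then (deform_br A ^^ n) (deform_br C \<mu>) X Y
         else - (deform_br A ^^ n) (deform_br C \<mu>) X Y)" if XY: "X \<in> S" "Y \<in> S" for n X Y
    using XY
  proof (induction n arbitrary: X Y)
    case (Suc n)
    let ?\<nu> = "(deform_br A ^^ n) \<mu>"
    have "deform_br C (deform_br A ?\<nu>) X Y = - deform_br A (deform_br C ?\<nu>) X Y"
      \<comment> \<open>Each exchange takes place over a different iterate of \<mu>, so
        compatibility is required for all of them.\<close>
      using compat_iter[OF A C \<mu> N K, of n] Suc.prems
      by (intro concom_uminus_swap) (simp add: compat_def)
    also have "deform_br A (deform_br C ?\<nu>) X Y
        = deform_br A (\<lambda>X Y. if even n then (deform_br A ^^ n) (deform_br C \<mu>) X Y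
            else - (deform_br A ^^ n) (deform_br C \<mu>) X Y) X Y"
      using Suc by (intro deform_br_cong A) auto
    finally show ?case
      using Suc.prems deform_br_uminus_arg[OF A biadditive_iter[OF A biadditive_deform_br[OF C \<mu>]]]
      by auto
  qed simp
  have "concom (A ^^ a) C \<mu> X Y = 0" if XY: "X \<in> S" "Y \<in> S" for X Y
  proof -
    have NC: "nij A (deform_br C \<mu>)"
      using nij_deform_br_other[OF A C \<mu> N anti K0] .
    have "deform_br C (deform_br (A ^^ a) \<mu>) X Y = deform_br C ((deform_br A ^^ a) \<mu>) X Y"
      using XY by (intro deform_br_cong C) (auto simp: deform_br_funpow A \<mu> N)
    also have "\<dots> = - (deform_br A ^^ a) (deform_br C \<mu>) X Y"
      using swap[OF XY] \<open>odd a\<close> by simp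
    also have "\<dots> = - deform_br (A ^^ a) (deform_br C \<mu>) X Y"
      by (simp add: deform_br_funpow A biadditive_deform_br C \<mu> NC XY)
    finally show ?thesis
      by (simp add: concom_def)
  qed
  moreover have "anticommute (A ^^ a) C"
    using anticommute_funpow[OF A C] K \<open>odd a\<close> by (simp add: compat_def anticommute_def)
  ultimately show ?thesis
    by (simp add: compat_def)
qed

text \<open>The odd power is taken last: iterating the deformation and composing with powers both
  work with \<open>A\<close> itself as the first member.\<close>

lemma compat_hierarchy:
  assumes "endo A" "endo C" "biadditive \<mu>" "nij A \<mu>" "compat A C \<mu>" "odd a"
  shows "compat (A ^^ a) ((A ^^ n) \<circ> C) ((deform_br A ^^ k) \<mu>)"
proof -
  note b = biadditive_iter[OF assms(1,3)] and n = nij_iter[OF assms(1,3,4)]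
  show ?thesis
    by (rule compat_odd_funpow[OF assms(1) endo_funpow_comp[OF assms(1,2)] b n
          compat_funpow_comp[OF assms(1,2) b n compat_iter[OF assms(1-5)]] assms(6)])
qed

end

section \<open>Smooth functions\<close>

text \<open>Makes partial derivatives at points of \<open>U\<close> depend only on values in
  \<open>U\<close>. The bound \<open>i < n\<close> keeps the coordinate line inside the model
  space.\<close>

lemma eventually_line_mem:
  assumes "openin (Euclidean_space n) U" "x \<in> U" "i < n"
  shows "\<forall>\<^sub>F t in nhds (x i). x(i := t) \<in> U"
proof -
  from assms(1) obtain T where T: "open T" and U: "U = T \<inter> {x. \<forall>i\<ge>n. x i = 0}"
    by (auto simp: Euclidean_space_def openin_subtopology euclidean_product_topology)
  have "continuous_on UNIV (\<lambda>t. x(i := t))"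
  proof (rule continuous_on_coordinatewise_then_product)
    show "continuous_on UNIV (\<lambda>t. (x(i := t)) j)" for j
      by (cases "j = i") simp_all
  qed
  then have "open ((\<lambda>t. x(i := t)) -` T)"
    using T by (simp add: continuous_on_open_vimage)
  then have "\<forall>\<^sub>F t in nhds (x i). t \<in> (\<lambda>t. x(i := t)) -` T"
    using assms(2) U by (intro eventually_nhds_in_open) auto
  then show ?thesis
    by (rule eventually_mono) (use assms(2,3) U in auto)
qed

text \<open>Differentiation is local by \<open>eventually_line_mem\<close>. This is what lets the
  sum and product rules, valid only on \<open>U\<close>, be used for the partial derivatives in the
  recursion.\<close>

lemma Ck_on_cong:
  assumes "openin (Euclidean_space n) U" "\<And>x. x \<in> U \<Longrightarrow> f x = g x" "Ck_on k n U f"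
  shows "Ck_on k n U g"
  using assms(2,3)
proof (induction k arbitrary: f g)
  case 0
  then show ?case by (simp cong: continuous_on_cong_simp)
next
  case (Suc k)
  have ev: "\<forall>\<^sub>F t in nhds (x i). f (x(i := t)) = g (x(i := t))" if "x \<in> U" "i < n" for x i
    using eventually_line_mem[OF assms(1) that] by (rule eventually_mono) (rule Suc.prems(1))
  have "partial_deriv i f x = partial_deriv i g x" if "x \<in> U" "i < n" for x i
    unfolding partial_deriv_def by (rule deriv_cong_ev[OF ev[OF that] refl])
  then have "Ck_on k n U (partial_deriv i g)" if "i < n" for i
    using Suc.IH[of "partial_deriv i f" "partial_deriv i g"] Suc.prems(2) that by simp
  moreover have "(\<lambda>t. g (x(i := t))) field_differentiable at (x i)" if "x \<in> U" "i < n" for x i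
  proof -
    have "(\<lambda>t. f (x(i := t))) field_differentiable at (x i)"
      using Suc.prems(2) that by simp
    then show ?thesis
      unfolding field_differentiable_def using DERIV_cong_ev[OF refl ev[OF that] refl] by blast
  qed
  moreover have "continuous_on U g"
    using Suc.prems by (simp cong: continuous_on_cong_simp)
  ultimately show ?case by simp
qed

lemma Ck_on_Suc_imp: "Ck_on (Suc k) n U f \<Longrightarrow> Ck_on k n U f"
  by (induction k arbitrary: f) auto

lemma Ck_on_const: "Ck_on k n U (\<lambda>_. c)"
proof (induction k arbitrary: c)
  case (Suc k)
  have "partial_deriv i (\<lambda>_. c) = (\<lambda>_. 0)" for i
    by (simp add: partial_deriv_def fun_eq_iff)
  then show ?case using Suc by simp
qed simp

lemma Ck_on_add:
  assumes U: "openin (Euclidean_space n) U" and "Ck_on k n U f" "Ck_on k n U g"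
  shows "Ck_on k n U (\<lambda>x. f x + g x)"
  using assms(2-)
proof (induction k arbitrary: f g)
  case (Suc k)
  have "Ck_on k n U (partial_deriv i (\<lambda>x. f x + g x))" if "i < n" for i
  proof (rule Ck_on_cong[OF U])
    show "Ck_on k n U (\<lambda>x. partial_deriv i f x + partial_deriv i g x)"
      using Suc that by simp
    show "partial_deriv i f x + partial_deriv i g x = partial_deriv i (\<lambda>x. f x + g x) x"
      if "x \<in> U" for x
      using Suc.prems \<open>i < n\<close> that by (simp add: partial_deriv_def deriv_add)
  qed
  then show ?case
    using Suc.prems by (auto intro!: continuous_on_add continuous_on_mult field_differentiable_add)
qed (auto intro: continuous_on_add continuous_on_mult)

lemma Ck_on_mult:
  assumes U: "openin (Euclidean_space n) U" and "Ck_on k n U f" "Ck_on k n U g"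
  shows "Ck_on k n U (\<lambda>x. f x * g x)"
  using assms(2-)
proof (induction k arbitrary: f g)
  case (Suc k)
  have "Ck_on k n U (partial_deriv i (\<lambda>x. f x * g x))" if "i < n" for i
  proof (rule Ck_on_cong[OF U])
    show "Ck_on k n U (\<lambda>x. f x * partial_deriv i g x + partial_deriv i f x * g x)"
      \<comment> \<open>In the Leibniz rule the undifferentiated factors have one order of
        differentiability to spare.\<close>
      using Suc.prems Suc.prems[THEN Ck_on_Suc_imp] that by (intro Ck_on_add[OF U] Suc.IH) simp_all
    show "f x * partial_deriv i g x + partial_deriv i f x * g x = partial_deriv i (\<lambda>x. f x * g x) x"
      if "x \<in> U" for x
      using Suc.prems \<open>i < n\<close> that by (simp add: partial_deriv_def deriv_mult)
  qed
  then show ?case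
    using Suc.prems by (auto intro!: continuous_on_add continuous_on_mult field_differentiable_mult)
qed (auto intro: continuous_on_add continuous_on_mult)

lemma Ck_on_subset: "Ck_on k n U f \<Longrightarrow> V \<subseteq> U \<Longrightarrow> Ck_on k n V f"
  by (induction k arbitrary: f) (auto intro: continuous_on_subset)

text \<open>Smoothness is tested on these images, and the calculus rules above require them to be
  open. A chart is a homeomorphism onto an open set, so relative openness is openness.\<close>

lemma openin_chart_image:
  assumes "smooth_atlas n \<A>" "(U,\<phi>) \<in> \<A>" "open W"
  shows "openin (Euclidean_space n) (\<phi> ` (U \<inter> W))"
proof -
  have o: "openin (Euclidean_space n) (\<phi> ` U)" and h: "homeomorphism U (\<phi> ` U) \<phi> (inv_into U \<phi>)"
    using assms(1,2) by (auto simp: smooth_atlas_def)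
  have "openin (top_of_set (\<phi> ` U)) (\<phi> ` (U \<inter> W))"
    using homeomorphism_imp_open_map[OF h] assms(3) by (simp add: openin_open_Int)
  then obtain T where T: "open T" "\<phi> ` (U \<inter> W) = \<phi> ` U \<inter> T"
    by (auto simp: openin_open)
  have "openin (Euclidean_space n) (T \<inter> topspace (Euclidean_space n))"
    using T(1) by (auto simp: Euclidean_space_def openin_subtopology euclidean_product_topology)
  moreover have "\<phi> ` (U \<inter> W) = \<phi> ` U \<inter> (T \<inter> topspace (Euclidean_space n))"
    using T(2) openin_subset[OF o] by blast
  ultimately show ?thesis
    using o by (simp add: openin_Int)
qed

section \<open>The algebra of smooth functions on a manifold\<close>

lemma smooth_fun_on_const: "smooth_fun_on n \<A> W (\<lambda>_. c)"
  by (auto simp: smooth_fun_on_def Cinf_on_def Ck_on_const)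

lemma smooth_fun_on_add:
  assumes "smooth_atlas n \<A>" "open W" "smooth_fun_on n \<A> W f" "smooth_fun_on n \<A> W g"
  shows "smooth_fun_on n \<A> W (\<lambda>x. f x + g x)"
  using assms(3,4) unfolding smooth_fun_on_def Cinf_on_def
  by (auto intro!: Ck_on_add openin_chart_image[OF assms(1) _ assms(2)])

lemma smooth_fun_on_mult:
  assumes "smooth_atlas n \<A>" "open W" "smooth_fun_on n \<A> W f" "smooth_fun_on n \<A> W g"
  shows "smooth_fun_on n \<A> W (\<lambda>x. f x * g x)"
  using assms(3,4) unfolding smooth_fun_on_def Cinf_on_def
  by (auto intro!: Ck_on_mult openin_chart_image[OF assms(1) _ assms(2)])

lemma smooth_fun_on_sum:
  assumes "smooth_atlas n \<A>" "open W" "\<And>i. i \<in> F \<Longrightarrow> smooth_fun_on n \<A> W (f i)"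
  shows "smooth_fun_on n \<A> W (\<lambda>x. \<Sum>i\<in>F. f i x)"
  using assms(3)
  by (induction F rule: infinite_finite_induct)
    (auto intro!: smooth_fun_on_const smooth_fun_on_add[OF assms(1,2)])

lemma smooth_fun_on_subset:
  assumes "smooth_fun_on n \<A> W f" "V \<subseteq> W"
  shows "smooth_fun_on n \<A> V f"
  using assms unfolding smooth_fun_on_def Cinf_on_def
  by (blast intro: Ck_on_subset)

section \<open>Tensors acting on sections\<close>

lemma tensor11_mem: "tensor11 B J \<Longrightarrow> u \<in> fibre B x \<Longrightarrow> J x u \<in> fibre B x"
  by (simp add: tensor11_def)

lemma tensor11_lincomb:
  assumes "tensor11 B J" "u \<in> fibre B x" "v \<in> fibre B x"
  shows "J x (a *\<^sub>R u + b *\<^sub>R v) = a *\<^sub>R J x u + b *\<^sub>R J x v"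
  using assms by (simp add: tensor11_def)

lemma tensor11_uminus:
  assumes "tensor11 B J" "u \<in> fibre B x"
  shows "J x (- u) = - J x u"
  using tensor11_lincomb[OF assms assms(2), of "-1" 0] by simp

lemma tensor11_sum:
  assumes "tensor11 B J" "subspace (fibre B x)" "\<And>i. i \<in> F \<Longrightarrow> v i \<in> fibre B x"
  shows "J x (\<Sum>i\<in>F. c i *\<^sub>R v i) = (\<Sum>i\<in>F. c i *\<^sub>R J x (v i))"
proof -
  have "0 \<in> fibre B x"
    using assms(2) by (rule subspace_0)
  then have "J x 0 = 0"
    using tensor11_lincomb[OF assms(1), of 0 x 0 0 0] by simp
  then show ?thesis
    using assms(3)
  proof (induction F rule: infinite_finite_induct)
    case (insert i F)
    have "(\<Sum>i\<in>F. c i *\<^sub>R v i) \<in> fibre B x"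
      using assms(2) insert.prems by (intro subspace_sum subspace_scale) auto
    then show ?case
      using insert tensor11_lincomb[OF assms(1), of "v i" x "\<Sum>i\<in>F. c i *\<^sub>R v i" "c i" 1] by simp
  qed auto
qed

lemma vector_bundle_frame:
  assumes "vector_bundle B" "(V,e) \<in> frames B"
  shows "open V" and "x \<in> V \<Longrightarrow> span ((\<lambda>i. e i x) ` {..<rk B}) = fibre B x"
proof -
  have "\<forall>(V,e)\<in>frames B. open V \<and>
      (\<forall>x\<in>V. inj_on (\<lambda>i. e i x) {..<rk B} \<and> independent ((\<lambda>i. e i x) ` {..<rk B}) \<and>
        span ((\<lambda>i. e i x) ` {..<rk B}) = fibre B x)"
    using assms(1) unfolding vector_bundle_def by (elim conjE)
  from bspec[OF this assms(2), unfolded prod.case]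
  show "open V" and "x \<in> V \<Longrightarrow> span ((\<lambda>i. e i x) ` {..<rk B}) = fibre B x"
    by simp_all
qed

lemma frame_mem:
  assumes "vector_bundle B" "(V,e) \<in> frames B" "x \<in> V" "i < rk B"
  shows "e i x \<in> fibre B x"
  unfolding vector_bundle_frame(2)[OF assms(1-3), symmetric]
  using assms(4) by (intro span_base) simp

lemma vector_bundle_atlas: "vector_bundle B \<Longrightarrow> smooth_atlas (mdim B) (charts B)"
  and vector_bundle_subspace: "vector_bundle B \<Longrightarrow> subspace (fibre B x)"
  by (simp_all add: vector_bundle_def)

text \<open>Change of coordinates: the new coefficients are the matrix \<open>a\<close> applied to
  the vector \<open>c\<close>.\<close>

lemma sum_scaleR_swap:
  fixes v :: "'i \<Rightarrow> 'v::real_vector"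
  shows "(\<Sum>j\<in>F. c j *\<^sub>R (\<Sum>i\<in>G. a i j *\<^sub>R v i)) = (\<Sum>i\<in>G. (\<Sum>j\<in>F. c j * a i j) *\<^sub>R v i)"
proof -
  have "(\<Sum>j\<in>F. c j *\<^sub>R (\<Sum>i\<in>G. a i j *\<^sub>R v i)) = (\<Sum>j\<in>F. \<Sum>i\<in>G. (c j * a i j) *\<^sub>R v i)"
    by (simp add: scaleR_sum_right)
  also have "\<dots> = (\<Sum>i\<in>G. \<Sum>j\<in>F. (c j * a i j) *\<^sub>R v i)"
    by (rule sum.swap)
  finally show ?thesis
    by (simp add: scaleR_sum_left)
qed

lemma tensor11_matrix:
  assumes "tensor11 B J" "(V,e) \<in> frames B" "(W,f) \<in> frames B"
  obtains a where "\<And>i j. i < rk B \<Longrightarrow> j < rk B \<Longrightarrow> smooth_on_base B (V \<inter> W) (a i j)"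
    and "\<And>x j. x \<in> V \<inter> W \<Longrightarrow> j < rk B \<Longrightarrow> J x (e j x) = (\<Sum>i<rk B. a i j x *\<^sub>R f i x)"
proof -
  have "\<forall>(V,e)\<in>frames B. \<forall>(W,f)\<in>frames B. \<exists>a.
      (\<forall>i<rk B. \<forall>j<rk B. smooth_on_base B (V \<inter> W) (a i j)) \<and>
      (\<forall>x\<in>V \<inter> W. \<forall>j<rk B. J x (e j x) = (\<Sum>i<rk B. a i j x *\<^sub>R f i x))"
    using assms(1) unfolding tensor11_def by (elim conjE)
  from bspec[OF bspec[OF this assms(2), unfolded prod.case] assms(3), unfolded prod.case]
  show ?thesis
    using that by blast
qed

section \<open>Sections and composition of tensors in local frames\<close>

lemma section_mem: "X \<in> sections B \<Longrightarrow> X x \<in> fibre B x"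
  by (simp add: sections_def)

lemma section_coeffs:
  assumes "X \<in> sections B" "(V,e) \<in> frames B"
  obtains c where "\<And>i. i < rk B \<Longrightarrow> smooth_on_base B V (c i)"
    and "\<And>x. x \<in> V \<Longrightarrow> X x = (\<Sum>i<rk B. c i x *\<^sub>R e i x)"
proof -
  have "\<forall>(V,e)\<in>frames B. \<exists>c. (\<forall>i<rk B. smooth_on_base B V (c i)) \<and>
      (\<forall>x\<in>V. X x = (\<Sum>i<rk B. c i x *\<^sub>R e i x))"
    using assms(1) by (simp add: sections_def)
  from bspec[OF this assms(2), unfolded prod.case] show ?thesis
    using that by blast
qed

lemma sectionI:
  assumes "\<And>x. X x \<in> fibre B x"
    and "\<And>V e. (V,e) \<in> frames B \<Longrightarrow>
      \<exists>c. (\<forall>i<rk B. smooth_on_base B V (c i)) \<and> (\<forall>x\<in>V. X x = (\<Sum>i<rk B. c i x *\<^sub>R e i x))"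
  shows "X \<in> sections B"
  using assms unfolding sections_def by blast

lemma section_lincomb:
  assumes B: "vector_bundle B" and X: "X \<in> sections B" and Y: "Y \<in> sections B"
  shows "(\<lambda>x. a *\<^sub>R X x + b *\<^sub>R Y x) \<in> sections B"
proof (rule sectionI)
  show "a *\<^sub>R X x + b *\<^sub>R Y x \<in> fibre B x" for x
    using X Y vector_bundle_subspace[OF B]
    by (intro subspace_add subspace_scale) (auto simp: section_mem)
next
  fix V e assume V: "(V,e) \<in> frames B"
  obtain c where c: "\<And>i. i < rk B \<Longrightarrow> smooth_on_base B V (c i)"
      "\<And>x. x \<in> V \<Longrightarrow> X x = (\<Sum>i<rk B. c i x *\<^sub>R e i x)"
    using section_coeffs[OF X V] by blast
  obtain d where d: "\<And>i. i < rk B \<Longrightarrow> smooth_on_base B V (d i)"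
      "\<And>x. x \<in> V \<Longrightarrow> Y x = (\<Sum>i<rk B. d i x *\<^sub>R e i x)"
    using section_coeffs[OF Y V] by blast
  note sm = vector_bundle_atlas[OF B] vector_bundle_frame(1)[OF B V]
  show "\<exists>c. (\<forall>i<rk B. smooth_on_base B V (c i)) \<and>
      (\<forall>x\<in>V. a *\<^sub>R X x + b *\<^sub>R Y x = (\<Sum>i<rk B. c i x *\<^sub>R e i x))"
  proof (intro exI conjI allI impI ballI)
    show "smooth_on_base B V (\<lambda>x. a * c i x + b * d i x)" if "i < rk B" for i
      using c(1) d(1) that
      by (intro smooth_fun_on_add[OF sm] smooth_fun_on_mult[OF sm] smooth_fun_on_const)
    show "a *\<^sub>R X x + b *\<^sub>R Y x = (\<Sum>i<rk B. (a * c i x + b * d i x) *\<^sub>R e i x)" if "x \<in> V" for x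
      using c(2) d(2) that
      by (simp add: scaleR_sum_right scaleR_add_left sum.distrib)
  qed
qed

lemma tapp_section:
  assumes B: "vector_bundle B" and J: "tensor11 B J" and X: "X \<in> sections B"
  shows "tapp J X \<in> sections B"
proof (rule sectionI)
  show "tapp J X x \<in> fibre B x" for x
    by (simp add: tapp_def tensor11_mem[OF J] section_mem[OF X])
next
  fix V e assume V: "(V,e) \<in> frames B"
  obtain c where c: "\<And>i. i < rk B \<Longrightarrow> smooth_on_base B V (c i)"
      "\<And>x. x \<in> V \<Longrightarrow> X x = (\<Sum>i<rk B. c i x *\<^sub>R e i x)"
    using section_coeffs[OF X V] by blast
  obtain a where a: "\<And>i j. i < rk B \<Longrightarrow> j < rk B \<Longrightarrow> smooth_on_base B V (a i j)"
      "\<And>x j. x \<in> V \<Longrightarrow> j < rk B \<Longrightarrow> J x (e j x) = (\<Sum>i<rk B. a i j x *\<^sub>R e i x)"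
    \<comment> \<open>The same frame serves for source and target, giving coefficients on all of
      \<open>V\<close>.\<close>
    using tensor11_matrix[OF J V V] by (metis Int_absorb)
  note sm = vector_bundle_atlas[OF B] vector_bundle_frame(1)[OF B V]
  show "\<exists>c. (\<forall>i<rk B. smooth_on_base B V (c i)) \<and>
      (\<forall>x\<in>V. tapp J X x = (\<Sum>i<rk B. c i x *\<^sub>R e i x))"
  proof (intro exI conjI allI impI ballI)
    show "smooth_on_base B V (\<lambda>x. \<Sum>j<rk B. c j x * a i j x)" if "i < rk B" for i
      using c(1) a(1) that
      by (intro smooth_fun_on_sum[OF sm] smooth_fun_on_mult[OF sm]) auto
    show "tapp J X x = (\<Sum>i<rk B. (\<Sum>j<rk B. c j x * a i j x) *\<^sub>R e i x)" if x: "x \<in> V" for x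
    proof -
      have "tapp J X x = (\<Sum>j<rk B. c j x *\<^sub>R J x (e j x))"
        using c(2)[OF x] frame_mem[OF B V x]
          tensor11_sum[OF J vector_bundle_subspace[OF B],
            where F = "{..<rk B}" and v = "\<lambda>j. e j x" and c = "\<lambda>j. c j x"]
        by (simp add: tapp_def)
      also have "\<dots> = (\<Sum>j<rk B. c j x *\<^sub>R (\<Sum>i<rk B. a i j x *\<^sub>R e i x))"
        using a(2)[OF x] by simp
      finally show ?thesis
        by (simp add: sum_scaleR_swap)
    qed
  qed
qed

lemma tensor11_tcomp:
  assumes B: "vector_bundle B" and I: "tensor11 B I" and J: "tensor11 B J"
  shows "tensor11 B (tcomp I J)"
proof -
  have "\<exists>a. (\<forall>i<rk B. \<forall>j<rk B. smooth_on_base B (V \<inter> W) (a i j)) \<and>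
      (\<forall>x\<in>V \<inter> W. \<forall>j<rk B. tcomp I J x (e j x) = (\<Sum>i<rk B. a i j x *\<^sub>R f i x))"
    if V: "(V,e) \<in> frames B" and W: "(W,f) \<in> frames B" for V e W f
  proof -
    obtain a where a: "\<And>i j. i < rk B \<Longrightarrow> j < rk B \<Longrightarrow> smooth_on_base B V (a i j)"
        "\<And>x j. x \<in> V \<Longrightarrow> j < rk B \<Longrightarrow> J x (e j x) = (\<Sum>i<rk B. a i j x *\<^sub>R e i x)"
      using tensor11_matrix[OF J V V] by (metis Int_absorb)
    obtain b where b: "\<And>i j. i < rk B \<Longrightarrow> j < rk B \<Longrightarrow> smooth_on_base B (V \<inter> W) (b i j)"
        "\<And>x j. x \<in> V \<inter> W \<Longrightarrow> j < rk B \<Longrightarrow> I x (e j x) = (\<Sum>i<rk B. b i j x *\<^sub>R f i x)"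
      using tensor11_matrix[OF I V W] by blast
    note sm = vector_bundle_atlas[OF B]
      open_Int[OF vector_bundle_frame(1)[OF B V] vector_bundle_frame(1)[OF B W]]
    show ?thesis
    \<comment> \<open>The matrix product: \<open>J\<close> is expressed from the frame
      \<open>e\<close> to itself, and only \<open>I\<close> changes to the frame
      \<open>f\<close>.\<close>
    proof (intro exI[of _ "\<lambda>i j x. \<Sum>l<rk B. a l j x * b i l x"] conjI allI impI ballI)
      show "smooth_on_base B (V \<inter> W) (\<lambda>x. \<Sum>l<rk B. a l j x * b i l x)" if "i < rk B" "j < rk B" for i j
        using smooth_fun_on_subset[OF a(1) Int_lower1] b(1) that
        by (intro smooth_fun_on_sum[OF sm] smooth_fun_on_mult[OF sm]) auto
      show "tcomp I J x (e j x) = (\<Sum>i<rk B. (\<Sum>l<rk B. a l j x * b i l x) *\<^sub>R f i x)"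
        if x: "x \<in> V \<inter> W" and j: "j < rk B" for x j
      proof -
        have "tcomp I J x (e j x) = (\<Sum>l<rk B. a l j x *\<^sub>R I x (e l x))"
          using a(2) x j frame_mem[OF B V]
            tensor11_sum[OF I vector_bundle_subspace[OF B],
              where F = "{..<rk B}" and v = "\<lambda>l. e l x" and c = "\<lambda>l. a l j x"]
          by (simp add: tcomp_def)
        also have "\<dots> = (\<Sum>l<rk B. a l j x *\<^sub>R (\<Sum>i<rk B. b i l x *\<^sub>R f i x))"
          using b(2)[OF x] by simp
        finally show ?thesis
          by (simp add: sum_scaleR_swap)
      qed
    qed
  qed
  note frames = this
  have "tcomp I J x (a *\<^sub>R u + b *\<^sub>R v) = a *\<^sub>R tcomp I J x u + b *\<^sub>R tcomp I J x v"
    if "u \<in> fibre B x" "v \<in> fibre B x" for x u v a b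
    using that by (simp add: tcomp_def tensor11_lincomb[OF I] tensor11_lincomb[OF J] tensor11_mem[OF J])
  moreover have "tcomp I J x u \<in> fibre B x" if "u \<in> fibre B x" for x u
    using that by (simp add: tcomp_def tensor11_mem[OF I] tensor11_mem[OF J])
  ultimately show ?thesis
    unfolding tensor11_def by (intro conjI) (blast, blast, clarify, rule frames)
qed

section \<open>Anticommuting and skew-symmetric tensors\<close>

definition tanticommute ::
  "('m::topological_space, 'e::real_vector) metric_bundle \<Rightarrow> ('m,'e) tensor11 \<Rightarrow> ('m,'e) tensor11 \<Rightarrow> bool"
  where "tanticommute B I J \<longleftrightarrow> (\<forall>x. \<forall>u\<in>fibre B x. I x (J x u) = - J x (I x u))"

lemma skew_tensor_tensor11: "skew_tensor B J \<Longrightarrow> tensor11 B J"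
  by (simp add: skew_tensor_def)

lemma skew_tensor_pairing:
  assumes "skew_tensor B J" "u \<in> fibre B x" "v \<in> fibre B x"
  shows "pairing B x (J x u) v = - pairing B x u (J x v)"
  using assms by (auto simp: skew_tensor_def eq_neg_iff_add_eq_0)

text \<open>Linearity is postulated in the first argument and carried over by symmetry.\<close>

lemma pairing_uminus_right:
  assumes "metric_vector_bundle B" "u \<in> fibre B x" "v \<in> fibre B x"
  shows "pairing B x u (- v) = - pairing B x u v"
proof -
  have sym: "pairing B x u w = pairing B x w u" if "w \<in> fibre B x" for w
    using assms(1,2) that by (simp add: metric_vector_bundle_def)
  have "subspace (fibre B x)"
    using assms(1) vector_bundle_subspace by (auto simp: metric_vector_bundle_def)
  then have neg: "- v \<in> fibre B x"
    using assms(3) by (rule subspace_neg)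
  have "pairing B x ((-1) *\<^sub>R v + 0 *\<^sub>R v) u = (-1) * pairing B x v u + 0 * pairing B x v u"
    using assms unfolding metric_vector_bundle_def by blast
  then show ?thesis
    using sym[OF assms(3)] sym[OF neg] by simp
qed

text \<open>The adjoint of \<open>I \<circ> J\<close> is \<open>J \<circ> I\<close>, the two signs
  cancelling, and anticommutation turns this into the negative of
  \<open>I \<circ> J\<close>.\<close>

lemma skew_tensor_tcomp:
  assumes B: "metric_vector_bundle B" and I: "skew_tensor B I" and J: "skew_tensor B J"
    and a: "tanticommute B I J"
  shows "skew_tensor B (tcomp I J)"
proof -
  note mI = tensor11_mem[OF skew_tensor_tensor11[OF I]] and mJ = tensor11_mem[OF skew_tensor_tensor11[OF J]]
  have "pairing B x (I x (J x u)) v = - pairing B x u (I x (J x v))"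
    if "u \<in> fibre B x" "v \<in> fibre B x" for x u v
  proof -
    have "pairing B x (I x (J x u)) v = pairing B x u (J x (I x v))"
      using that by (simp add: skew_tensor_pairing[OF I] skew_tensor_pairing[OF J] mI mJ)
    moreover have "I x (J x v) = - J x (I x v)"
      using a that by (simp add: tanticommute_def)
    ultimately show ?thesis
      using that by (simp add: pairing_uminus_right[OF B] mI mJ)
  qed
  then show ?thesis
    using tensor11_tcomp[of B I J] B I J
    by (auto simp: skew_tensor_def metric_vector_bundle_def tcomp_def)
qed

lemma tcomp_tpow_Suc: "tcomp (tpow I (Suc n)) J = tcomp I (tcomp (tpow I n) J)"
  by (simp add: tcomp_def tpow_def fun_eq_iff)

lemma tcomp_tpow_0: "tcomp (tpow I 0) J = J"
  by (simp add: tcomp_def tpow_def fun_eq_iff)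

lemma tanticommute_tcomp:
  assumes "tensor11 B I" "tensor11 B J" "tanticommute B I J"
  shows "tanticommute B I (tcomp I J)"
  using assms by (simp add: tanticommute_def tcomp_def tensor11_mem tensor11_uminus)

lemma skew_tensor_tpow_tcomp:
  assumes "metric_vector_bundle B" "skew_tensor B I" "skew_tensor B J" "tanticommute B I J"
  shows "skew_tensor B (tcomp (tpow I n) J) \<and> tanticommute B I (tcomp (tpow I n) J)"
proof (induction n)
  case 0
  then show ?case
    using assms by (simp add: tcomp_tpow_0)
next
  case (Suc n)
  then show ?case
    using assms by (simp add: tcomp_tpow_Suc skew_tensor_tcomp tanticommute_tcomp skew_tensor_tensor11)
qed

lemma tpow_mem: "tensor11 B I \<Longrightarrow> u \<in> fibre B x \<Longrightarrow> (I x ^^ n) u \<in> fibre B x"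
  by (induction n) (auto simp: tensor11_mem)

lemma tpow_uminus: "tensor11 B I \<Longrightarrow> u \<in> fibre B x \<Longrightarrow> (I x ^^ n) (- u) = - (I x ^^ n) u"
  by (induction n) (auto simp: tensor11_uminus tpow_mem)

text \<open>The induction starts from \<open>I\<close> itself; the exponents needed later are odd,
  hence positive.\<close>

lemma tensor11_tpow_Suc:
  assumes "vector_bundle B" "tensor11 B I"
  shows "tensor11 B (tpow I (Suc n))"
proof (induction n)
  case 0
  then show ?case
    using assms by (simp add: tpow_def)
next
  case (Suc n)
  have "tpow I (Suc (Suc n)) = tcomp I (tpow I (Suc n))"
    by (simp add: tcomp_def tpow_def fun_eq_iff)
  then show ?case
    using tensor11_tcomp[OF assms Suc] by simp
qed

lemma skew_tensor_odd_tpow: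
  assumes B: "metric_vector_bundle B" and I: "skew_tensor B I" and "odd n"
  shows "skew_tensor B (tpow I n)"
proof -
  note t = skew_tensor_tensor11[OF I]
  \<comment> \<open>Each factor moved across the pairing contributes a sign; an odd number of them
    leaves skew-symmetry.\<close>
  have "pairing B x ((I x ^^ n) u) v = (-1) ^ n * pairing B x u ((I x ^^ n) v)"
    if "u \<in> fibre B x" "v \<in> fibre B x" for x u v n
    using that
  proof (induction n arbitrary: v)
    case (Suc n)
    then show ?case
      using skew_tensor_pairing[OF I, of "(I x ^^ n) u" x v] Suc.IH[of "I x v"]
      by (simp add: tpow_mem[OF t] tensor11_mem[OF t] funpow_swap1)
  qed simp
  moreover have "tensor11 B (tpow I n)"
    using tensor11_tpow_Suc[of B I "n - 1"] B t \<open>odd n\<close>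
    by (auto simp: metric_vector_bundle_def odd_pos)
  ultimately show ?thesis
    using \<open>odd n\<close> by (simp add: skew_tensor_def tpow_def)
qed

lemma tanticommute_odd_tpow:
  assumes "tensor11 B I" "tensor11 B J" "tanticommute B I J" "odd n"
  shows "tanticommute B (tpow I n) J"
proof -
  have "(I x ^^ n) (J x u) = (if even n then J x ((I x ^^ n) u) else - J x ((I x ^^ n) u))"
    if "u \<in> fibre B x" for x u n
    using assms(3) that
    by (induction n)
      (auto simp: tanticommute_def tpow_mem[OF assms(1)] tensor11_mem[OF assms(2)]
        tensor11_uminus[OF assms(1)])
  then show ?thesis
    using assms(4) by (simp add: tanticommute_def tpow_def)
qed


section \<open>Compatible pairs\<close>

text \<open>Uses the pointwise group structure on functions; 2-torsion is absent because the values
  lie in a real vector space.\<close>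

lemma additive_carrier_sections:
  fixes B :: "('m::{t2_space,second_countable_topology}, 'e::real_vector) metric_bundle"
  assumes "vector_bundle B"
  shows "additive_carrier (sections B)"
proof
  show "X + Y \<in> sections B" if "X \<in> sections B" "Y \<in> sections B" for X Y
    using section_lincomb[OF assms that, of 1 1] by (simp add: plus_fun_def)
  show "- X \<in> sections B" if "X \<in> sections B" for X
    using section_lincomb[OF assms that that, of "-1" 0] by (simp add: fun_Compl_def)
  show "v = 0" if "v + v = 0" for v :: "'m \<Rightarrow> 'e"
  proof
    fix x
    have "v x + v x = 0"
      using that by (simp add: fun_eq_iff)
    then have "2 *\<^sub>R v x = 0"
      by (simp add: scaleR_2)
    then show "v x = 0 x"
      by simp
  qed
qed

lemma endo_tapp:
  assumes "vector_bundle B" "tensor11 B J"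
  shows "additive_carrier.endo (sections B) (tapp J)"
proof -
  interpret additive_carrier "sections B"
    using assms(1) by (rule additive_carrier_sections)
  have "tapp J (X + Y) = tapp J X + tapp J Y" if "X \<in> sections B" "Y \<in> sections B" for X Y
    using tensor11_lincomb[OF assms(2) section_mem[OF that(1)] section_mem[OF that(2)], of _ 1 1]
    by (simp add: tapp_def fun_eq_iff)
  then show ?thesis
    using tapp_section[OF assms] by (simp add: endo_def)
qed

lemma biadditive_bracket:
  assumes "vector_bundle B" "pre_courant_structure B \<Theta>"
  shows "additive_carrier.biadditive (sections B) (bracket \<Theta>)"
proof -
  interpret additive_carrier "sections B"
    using assms(1) by (rule additive_carrier_sections)
  have closed: "bracket \<Theta> X Y \<in> sections B" if "X \<in> sections B" "Y \<in> sections B" for X Y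
    using assms(2) that by (simp add: pre_courant_structure_def)
  \<comment> \<open>Coefficients 1 extract additivity from real bilinearity.\<close>
  have "bracket \<Theta> (\<lambda>x. 1 *\<^sub>R X x + 1 *\<^sub>R Y x) Z = (\<lambda>x. 1 *\<^sub>R bracket \<Theta> X Z x + 1 *\<^sub>R bracket \<Theta> Y Z x)"
      "bracket \<Theta> Z (\<lambda>x. 1 *\<^sub>R X x + 1 *\<^sub>R Y x) = (\<lambda>x. 1 *\<^sub>R bracket \<Theta> Z X x + 1 *\<^sub>R bracket \<Theta> Z Y x)"
    if "X \<in> sections B" "Y \<in> sections B" "Z \<in> sections B" for X Y Z
    using assms(2) that unfolding pre_courant_structure_def by blast+
  then show ?thesis
    using closed by (simp add: biadditive_def endo_def plus_fun_def)
qed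

section \<open>From structures on the bundle to brackets of sections\<close>

lemma bracket_deform: "bracket (deform \<Theta> J) = deform_br (tapp J) (bracket \<Theta>)"
  by (simp add: deform_def deform_br_def tapp_def fun_eq_iff)

lemma bracket_deform_iter: "bracket (deform_iter \<Theta> I k) = (deform_br (tapp I) ^^ k) (bracket \<Theta>)"
  by (induction k) (simp_all add: bracket_deform)

lemma anchor_deform_iter: "anchor (deform_iter \<Theta> I k) x u = anchor \<Theta> x ((I x ^^ k) u)"
  by (induction k arbitrary: u) (simp_all add: deform_def funpow_swap1)

lemma tapp_tcomp: "tapp (tcomp I J) = tapp I \<circ> tapp J"
  by (simp add: tapp_def tcomp_def fun_eq_iff)

lemma tapp_tpow: "tapp (tpow I n) = tapp I ^^ n"
proof
  show "tapp (tpow I n) X = (tapp I ^^ n) X" for X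
    by (induction n) (simp_all add: tapp_def tpow_def fun_eq_iff)
qed

text \<open>The anchor of the concomitant is the original anchor composed with \<open>K ^^ k\<close>
  and the anticommutator of \<open>A\<close> and \<open>C\<close>, so it vanishes by
  anticommutation. Only the bracket is left, and there the two notions agree.\<close>

lemma zero_concomitant_deform_iter_iff:
  fixes B :: "('m::{t2_space,second_countable_topology}, 'e::real_vector) metric_bundle"
  assumes B: "vector_bundle B" and \<rho>: "anchor_map B (anchor \<Theta>)" and K: "tensor11 B K"
    and C: "tensor11 B C" and A: "tensor11 B A" and a: "tanticommute B A C"
  shows "zero_structure B (concomitant (deform_iter \<Theta> K k) A C) \<longleftrightarrow>
    additive_carrier.compat (sections B) (tapp A) (tapp C) ((deform_br (tapp K) ^^ k) (bracket \<Theta>))"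
proof -
  interpret additive_carrier "sections B"
    using B by (rule additive_carrier_sections)
  have "anchor (concomitant (deform_iter \<Theta> K k) A C) x u f = 0"
    if u: "u \<in> fibre B x" and f: "smooth_on_base B UNIV f" for x u f
  proof -
    let ?w = "(K x ^^ k) (C x (A x u))"
    have w: "?w \<in> fibre B x"
      using u by (simp add: tpow_mem[OF K] tensor11_mem[OF A] tensor11_mem[OF C])
    have "A x (C x u) = - C x (A x u)"
      using a u by (simp add: tanticommute_def)
    then have "(K x ^^ k) (A x (C x u)) = - ?w"
      using u by (simp add: tpow_uminus[OF K] tensor11_mem[OF A] tensor11_mem[OF C])
    \<comment> \<open>The coefficients -1 and 0 express negation in the form in which linearity of
      the anchor is given.\<close>
    moreover have "anchor \<Theta> x ((-1) *\<^sub>R ?w + 0 *\<^sub>R ?w) f = (-1) * anchor \<Theta> x ?w f + 0 * anchor \<Theta> x ?w f"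
      using \<rho> w f unfolding anchor_map_def by blast
    ultimately show ?thesis
      by (simp add: concomitant_def plus_structure_def deform_def anchor_deform_iter)
  qed
  moreover have "bracket (concomitant (deform_iter \<Theta> K k) A C) X Y
      = concom (tapp A) (tapp C) ((deform_br (tapp K) ^^ k) (bracket \<Theta>)) X Y" for X Y
    by (simp add: concomitant_def plus_structure_def bracket_deform bracket_deform_iter concom_def
        fun_eq_iff)
  moreover have "anticommute (tapp A) (tapp C)"
    using a by (simp add: anticommute_def tanticommute_def tapp_def section_mem fun_eq_iff)
  ultimately show ?thesis
    by (simp add: zero_structure_def compat_def fun_eq_iff)
qed

section \<open>The hierarchy of compatible pairs\<close>

lemma compatible_pair_sym:
  assumes "compatible_pair B \<Theta> I J"
  shows "compatible_pair B \<Theta> J I"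
proof -
  have "concomitant \<Theta> J I = concomitant \<Theta> I J"
    by (simp add: concomitant_def plus_structure_def add.commute)
  then show ?thesis
    using assms by (simp add: compatible_pair_def tcomp_def)
qed

lemma compatible_pair_tanticommute: "compatible_pair B \<Theta> I J \<Longrightarrow> tanticommute B I J"
  by (simp add: compatible_pair_def tcomp_def tanticommute_def)

text \<open>Translates \<open>compat_hierarchy\<close> to the bundle. Being stated for an arbitrary
  tensor compatible with a Nijenhuis one, it also applies with the two roles exchanged.\<close>

lemma compatible_pair_hierarchy:
  fixes B :: "('m::{t2_space,second_countable_topology}, 'e::real_vector) metric_bundle"
  assumes \<Theta>: "pre_courant_algebroid B \<Theta>" and N: "nijenhuis B \<Theta> I" and C: "compatible_pair B \<Theta> I J"
    and "odd a"
  shows "compatible_pair B (deform_iter \<Theta> I k) (tpow I a) (tcomp (tpow I n) J)"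
proof -
  have M: "metric_vector_bundle B" and S: "pre_courant_structure B \<Theta>"
    using \<Theta> by (auto simp: pre_courant_algebroid_def)
  have B: "vector_bundle B"
    using M by (simp add: metric_vector_bundle_def)
  have \<rho>: "anchor_map B (anchor \<Theta>)"
    using S by (simp add: pre_courant_structure_def)
  interpret additive_carrier "sections B"
    using B by (rule additive_carrier_sections)
  have I: "skew_tensor B I" and J: "skew_tensor B J" and a: "tanticommute B I J"
    using C compatible_pair_tanticommute[OF C] by (auto simp: compatible_pair_def)
  note tI = skew_tensor_tensor11[OF I] and tJ = skew_tensor_tensor11[OF J]
  have skew: "skew_tensor B (tcomp (tpow I n) J)" and an: "tanticommute B I (tcomp (tpow I n) J)"
    using skew_tensor_tpow_tcomp[OF M I J a] by auto
  note tn = skew_tensor_tensor11[OF skew]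
  have odd: "skew_tensor B (tpow I a)" and anti: "tanticommute B (tpow I a) (tcomp (tpow I n) J)"
    using skew_tensor_odd_tpow[OF M I] tanticommute_odd_tpow[OF tI tn an] \<open>odd a\<close> by auto
  have "nij (tapp I) (bracket \<Theta>)"
    using N by (simp add: nijenhuis_def nij_def torsion_def bracket_deform tapp_def fun_eq_iff)
  moreover have "compat (tapp I) (tapp J) (bracket \<Theta>)"
    \<comment> \<open>With zero iterations the structure is \<Theta> itself, and the deforming
      tensor is a mere placeholder.\<close>
    using zero_concomitant_deform_iter_iff[OF B \<rho> tI tJ tI a, of 0] C by (simp add: compatible_pair_def)
  ultimately have "compat (tapp (tpow I a)) (tapp (tcomp (tpow I n) J))
      ((deform_br (tapp I) ^^ k) (bracket \<Theta>))"
    unfolding tapp_tcomp tapp_tpow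
    by (intro compat_hierarchy endo_tapp B tI tJ biadditive_bracket S \<open>odd a\<close>)
  then have "zero_structure B (concomitant (deform_iter \<Theta> I k) (tpow I a) (tcomp (tpow I n) J))"
    using zero_concomitant_deform_iter_iff[OF B \<rho> tI tn skew_tensor_tensor11[OF odd] anti] by blast
  then show ?thesis
    using skew odd anti by (simp add: compatible_pair_def tanticommute_def tcomp_def)
qed

theorem theorem2p22:
  fixes B :: "('m::{t2_space,second_countable_topology}, 'e::real_vector) metric_bundle"
    and \<Theta> :: "('m,'e) courant_data"
    and I J :: "('m,'e) tensor11"
  assumes "pre_courant_algebroid B \<Theta>"
    and "skew_tensor B I"
    and "skew_tensor B J"
    and "nijenhuis B \<Theta> I"
    and "compatible_pair B \<Theta> I J"
  shows "(\<forall>k n s :: nat.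
            zero_structure B
              (concomitant (deform_iter \<Theta> I k) (tpow I (2 * s + 1)) (tcomp (tpow I n) J)) \<and>
            compatible_pair B (deform_iter \<Theta> I k) (tpow I (2 * s + 1)) (tcomp (tpow I n) J)) \<and>
         (nijenhuis B \<Theta> J \<longrightarrow>
          (\<forall>k m n s :: nat.
            zero_structure B
              (concomitant (deform_iter \<Theta> I k) (tpow I (2 * s + 1))
                 (tcomp (tpow I n) (tpow J (2 * m + 1)))) \<and>
            compatible_pair B (deform_iter \<Theta> I k) (tpow I (2 * s + 1))
              (tcomp (tpow I n) (tpow J (2 * m + 1)))))"
proof -
  \<comment> \<open>The hierarchy of \<open>J\<close> with \<open>I\<close> as partner, taken with
    no deformation and exponent 0 in front of \<open>I\<close>, then read in reverse order.\<close>
  have powers: "compatible_pair B \<Theta> I (tpow J (2 * m + 1))" if "nijenhuis B \<Theta> J" for m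
  proof (rule compatible_pair_sym)
    show "compatible_pair B \<Theta> (tpow J (2 * m + 1)) I"
      using compatible_pair_hierarchy[OF assms(1) that compatible_pair_sym[OF assms(5)],
          of "2 * m + 1" 0 0]
      by (simp add: tcomp_tpow_0)
  qed
  \<comment> \<open>\<open>K\<close> is \<open>J\<close> for the first claim and an odd power of
    \<open>J\<close> for the second.\<close>
  have "compatible_pair B (deform_iter \<Theta> I k) (tpow I (2 * s + 1)) (tcomp (tpow I n) K)"
    if "compatible_pair B \<Theta> I K" for k n s K
    by (rule compatible_pair_hierarchy[OF assms(1,4) that]) simp
  with assms(5) powers show ?thesis
    by (auto simp: compatible_pair_def)
qed

end
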